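(* Let $\mathcal{P}=(P,\le)$ be a poset with $|P|\ge 3$ and height at most $2$. Then there are two (distinct) elements $x,y$ in $P$ such that $$\operatorname{ldim}(\mathcal{P})\le \operatorname{ldim}(\mathcal{P}-\{x,y\})+1.$$
   Context: Posets are finite and nonempty. The height of a poset is the maximum number of elements in a chain. $\mathcal{P}-S$ denotes the subposet induced on $P\setminus S$. A partial linear extension (ple) of a poset $\mathcal{P}=(P,\le)$ is a linear extension of a (nonempty) subposet of $\mathcal{P}$, i.e. a linear order on a nonempty subset $S\subseteq P$ that extends the order induced by $\mathcal{P}$ on $S$. A local realizer of $\mathcal{P}$ is a non-empty family $\mathcal{L}$ of ple's of $\mathcal{P}$ such that (i) if $x<y$ in $\mathcal{P}$, then some $L\in\mathcal{L}$ contains $x,y$ with $x<y$ in $L$; (ii) if $x$ and $y$ are incomparable in $\mathcal{P}$, then there are $L,L'\in\mathcal{L}$ with $x<y$ in $L$ and $x>y$ in $L'$. For $x\in P$, the frequency $\mu(x,\mathcal{L})$ is the number of ple's in $\mathcal{L}$ containing $x$, and $\mu(\mathcal{L})=\max_{x\in P}\mu(x,\mathcal{L})$. The local dimension is $\operatorname{ldim}(\mathcal{P})=\min_{\mathcal{L}}\mu(\mathcal{L})$, the minimum over all local realizers $\mathcal{L}$ of $\mathcal{P}$. (In particular a one-element poset has local dimension $1$.) *)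

theory Defs
  imports Main
begin

text \<open>A poset is given by its ground set \<open>P\<close> and its order relation \<open>r\<close>, subject to
  \<open>partial_order_on P r\<close> (which includes \<open>r \<subseteq> P \<times> P\<close>).\<close>

definition height :: "'a set \<Rightarrow> 'a rel \<Rightarrow> nat" where
  "height P r = Max {card C | C. C \<subseteq> P \<and> C \<in> Chains r}"

definition partial_linear_extension :: "'a set \<Rightarrow> 'a rel \<Rightarrow> 'a rel \<Rightarrow> bool" where
  "partial_linear_extension P r L \<longleftrightarrow>
     (\<exists>S. S \<noteq> {} \<and> S \<subseteq> P \<and> linear_order_on S L \<and> Restr r S \<subseteq> L)"

text \<open>The orders in \<open>R\<close> are reflexive and antisymmetric, so for \<open>x \<noteq> y\<close> the membership
  \<open>(x, y) \<in> L\<close> says that \<open>L\<close> contains both elements and places \<open>x\<close> strictly below \<open>y\<close>.\<close>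

definition local_realizer :: "'a set \<Rightarrow> 'a rel \<Rightarrow> 'a rel set \<Rightarrow> bool" where
  "local_realizer P r R \<longleftrightarrow>
     R \<noteq> {} \<and> (\<forall>L\<in>R. partial_linear_extension P r L) \<and>
     (\<forall>x\<in>P. \<forall>y\<in>P. x \<noteq> y \<and> (x, y) \<in> r \<longrightarrow> (\<exists>L\<in>R. (x, y) \<in> L)) \<and>
     (\<forall>x\<in>P. \<forall>y\<in>P. (x, y) \<notin> r \<and> (y, x) \<notin> r \<longrightarrow>
        (\<exists>L\<in>R. \<exists>L'\<in>R. (x, y) \<in> L \<and> (y, x) \<in> L'))"

text \<open>By reflexivity, the elements contained in an extension \<open>L\<close> are exactly those of \<open>Field L\<close>.\<close>

definition frequency :: "'a \<Rightarrow> 'a rel set \<Rightarrow> nat" where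
  "frequency x R = card {L \<in> R. x \<in> Field L}"

definition max_frequency :: "'a set \<Rightarrow> 'a rel set \<Rightarrow> nat" where
  "max_frequency P R = Max ((\<lambda>x. frequency x R) ` P)"

definition ldim :: "'a set \<Rightarrow> 'a rel \<Rightarrow> nat" where
  "ldim P r = (LEAST k. \<exists>R. local_realizer P r R \<and> max_frequency P R = k)"

text \<open>The minimum is attained: on a nonempty ground set, the linear orders on one or two
  elements that extend \<open>r\<close> form a local realizer.\<close>

lemma local_realizer_exists:
  assumes "partial_order_on P r" and "P \<noteq> {}"
  shows "\<exists>R. local_realizer P r R"
proof -
  define R where
    "R = {{(x, x), (x, y), (y, y)} | x y. x \<in> P \<and> y \<in> P \<and> (x = y \<or> (y, x) \<notin> r)}"
  have anti: "antisym r"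
    using assms(1) by (simp add: partial_order_on_def)
  have mem: "{(x, x), (x, y), (y, y)} \<in> R" if "x \<in> P" "y \<in> P" "x = y \<or> (y, x) \<notin> r" for x y
    using that unfolding R_def by blast
  have ple: "partial_linear_extension P r L" if LR: "L \<in> R" for L
  proof -
    obtain x y where L: "L = {(x, x), (x, y), (y, y)}" and xy: "x \<in> P" "y \<in> P" "x = y \<or> (y, x) \<notin> r"
      using LR unfolding R_def by blast
    have "linear_order_on {x, y} L"
      unfolding L linear_order_on_def partial_order_on_def preorder_on_def
      apply (intro conjI)
      apply blast
      apply (simp add: refl_on_def)
      apply (rule transI, force)
      apply (rule antisymI, force)
      apply (simp add: total_on_def)
      done
    moreover have "Restr r {x, y} \<subseteq> L"
      using xy(3) unfolding L by blast
    moreover have "{x, y} \<noteq> {}" and "{x, y} \<subseteq> P"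
      using xy by simp_all
    ultimately show ?thesis
      unfolding partial_linear_extension_def by (intro exI[of _ "{x, y}"] conjI)
  qed
  have pair: "\<exists>L\<in>R. (x, y) \<in> L" if "x \<in> P" "y \<in> P" "x = y \<or> (y, x) \<notin> r" for x y
    using mem[OF that] by (rule bexI[rotated]) simp
  have "local_realizer P r R"
    unfolding local_realizer_def
  proof (intro conjI ballI impI)
    show "R \<noteq> {}"
      using assms(2) pair by fast
  next
    fix x y
    assume "x \<in> P" "y \<in> P" "x \<noteq> y \<and> (x, y) \<in> r"
    then show "\<exists>L\<in>R. (x, y) \<in> L"
      using antisymD[OF anti, of x y] by (intro pair) auto
  next
    fix x y
    assume xy: "x \<in> P" "y \<in> P" "(x, y) \<notin> r \<and> (y, x) \<notin> r"
    have "\<exists>L\<in>R. (x, y) \<in> L" and "\<exists>L\<in>R. (y, x) \<in> L"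
      using xy by (simp_all add: pair)
    then show "\<exists>L\<in>R. \<exists>L'\<in>R. (x, y) \<in> L \<and> (y, x) \<in> L'"
      by blast
  qed (rule ple)
  then show ?thesis ..
qed

lemma ldim_attained:
  assumes "partial_order_on P r" and "P \<noteq> {}"
  shows "\<exists>R. local_realizer P r R \<and> max_frequency P R = ldim P r"
  unfolding ldim_def by (rule LeastI_ex) (use local_realizer_exists[OF assms] in blast)

end

theory Submission
  imports Defs
begin

text \<open>Any two elements of a poset occur together in some member of a local realizer, so the at
  most \<open>k\<close> members containing a fixed element \<open>z\<close> jointly cover the ground set. Let \<open>a\<close> be minimal,
  \<open>b\<close> maximal and \<open>a\<close>, \<open>b\<close> incomparable. Given a local realizer of the poset without \<open>a\<close> and \<open>b\<close>,
  put \<open>a\<close> at the bottom and \<open>b\<close> at the top of the members containing \<open>z\<close>, and add one linear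
  extension of the whole poset that has \<open>b\<close> as low and \<open>a\<close> as high as possible; every frequency
  grows by at most one. If there is no such pair, a poset of height at most 2 is a complete
  bipartite order, which is realized by two linear extensions.\<close>

subsection \<open>Local realizers\<close>

text \<open>Both realizer conditions follow from one: whenever \<open>y\<close> is not below
  \<open>x\<close>, some member puts \<open>x\<close> below \<open>y\<close>. Antisymmetry gives the
  comparable pairs, and using it in both directions gives the incomparable ones.\<close>

lemma local_realizerI:
  assumes po: "partial_order_on P r"
    and "R \<noteq> {}"
    and "\<And>L. L \<in> R \<Longrightarrow> partial_linear_extension P r L"
    and pair: "\<And>x y. \<lbrakk>x \<in> P; y \<in> P; x \<noteq> y; (y, x) \<notin> r\<rbrakk> \<Longrightarrow> \<exists>L\<in>R. (x, y) \<in> L"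
  shows "local_realizer P r R"
  unfolding local_realizer_def
proof (intro conjI ballI impI)
  fix x y assume "x \<in> P" "y \<in> P" "x \<noteq> y \<and> (x, y) \<in> r"
  then show "\<exists>L\<in>R. (x, y) \<in> L"
    using pair[of x y] po antisymD[of r x y] by (auto simp: partial_order_on_def)
next
  fix x y assume xy: "x \<in> P" "y \<in> P" "(x, y) \<notin> r \<and> (y, x) \<notin> r"
  then have "x \<noteq> y"
    using po by (auto simp: partial_order_on_def preorder_on_def refl_on_def)
  then show "\<exists>L\<in>R. \<exists>L'\<in>R. (x, y) \<in> L \<and> (y, x) \<in> L'"
    using xy pair[of x y] pair[of y x] by blast
qed (use assms in auto)

lemma local_realizer_pairD:
  assumes "local_realizer P r R" "x \<in> P" "y \<in> P" "x \<noteq> y" "(y, x) \<notin> r"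
  shows "\<exists>L\<in>R. (x, y) \<in> L"
  using assms unfolding local_realizer_def by blast

text \<open>Reflexivity forces the existentially quantified carrier to be \<open>Field L\<close>, so
  it can be eliminated.\<close>

lemma partial_linear_extensionD:
  assumes "partial_linear_extension P r L"
  shows "Field L \<noteq> {}" "Field L \<subseteq> P" "linear_order_on (Field L) L" "Restr r (Field L) \<subseteq> L"
proof -
  obtain S where S: "S \<noteq> {}" "S \<subseteq> P" "linear_order_on S L" "Restr r S \<subseteq> L"
    using assms unfolding partial_linear_extension_def by blast
  have "Field L = S"
    using S(3) unfolding linear_order_on_def partial_order_on_def preorder_on_def refl_on_def
    by (auto simp: Field_def)
  then show "Field L \<noteq> {}" "Field L \<subseteq> P" "linear_order_on (Field L) L" "Restr r (Field L) \<subseteq> L"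
    using S by simp_all
qed

text \<open>Comparable or not, two distinct elements are ordered by some member. For
  \<open>x = y\<close> a second element helps; in a one-element poset any member will do, since the
  family and its carriers are nonempty.\<close>

lemma local_realizer_covers:
  assumes R: "local_realizer P r R" and x: "x \<in> P" and y: "y \<in> P"
  shows "\<exists>L\<in>R. x \<in> Field L \<and> y \<in> Field L"
proof -
  have *: "\<exists>L\<in>R. u \<in> Field L \<and> v \<in> Field L" if "u \<in> P" "v \<in> P" "u \<noteq> v" for u v
  proof -
    have "\<exists>L\<in>R. (u, v) \<in> L \<or> (v, u) \<in> L"
      using R that unfolding local_realizer_def by metis
    then show ?thesis by (auto simp: Field_def)
  qed
  show ?thesis
  proof (cases "\<exists>v\<in>P. v \<noteq> x")
    case True
    then show ?thesis using * x y by metis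
  next
    case False
    obtain L where "L \<in> R" "partial_linear_extension P r L"
      using R unfolding local_realizer_def by blast
    then obtain v where "v \<in> Field L" "v \<in> P"
      using partial_linear_extensionD(1,2)[of P r L] by blast
    then show ?thesis
      using False x y \<open>L \<in> R\<close> by metis
  qed
qed

text \<open>Frequencies are cardinalities, and \<open>card\<close> is 0 on infinite sets; finiteness
  makes them genuine counts.\<close>

lemma finite_local_realizer:
  assumes "finite P" "local_realizer P r R"
  shows "finite R"
proof (rule finite_subset)
  show "R \<subseteq> Pow (P \<times> P)"
  proof (rule subsetI, rule PowI)
    fix L assume "L \<in> R"
    then have "partial_linear_extension P r L"
      using assms(2) unfolding local_realizer_def by blast
    then have "Field L \<subseteq> P" by (rule partial_linear_extensionD(2))
    then show "L \<subseteq> P \<times> P" by (auto simp: Field_def)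
  qed
qed (use assms(1) in simp)

lemma ldim_le:
  assumes "finite P" "P \<noteq> {}" "local_realizer P r R" "\<And>x. x \<in> P \<Longrightarrow> frequency x R \<le> k"
  shows "ldim P r \<le> k"
proof -
  have "ldim P r \<le> max_frequency P R"
    unfolding ldim_def using assms(3) by (intro Least_le) blast
  also have "\<dots> \<le> k"
    unfolding max_frequency_def using assms by (subst Max_le_iff) auto
  finally show ?thesis .
qed

lemma ldim_realizer:
  assumes "finite P" "P \<noteq> {}" "partial_order_on P r"
  obtains R where "local_realizer P r R" "\<And>x. x \<in> P \<Longrightarrow> frequency x R \<le> ldim P r"
proof -
  obtain R where R: "local_realizer P r R" "max_frequency P R = ldim P r"
    using ldim_attained assms by blast
  have "frequency x R \<le> ldim P r" if "x \<in> P" for x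
    using that assms(1) unfolding R(2)[symmetric] max_frequency_def by simp
  with R(1) show thesis by (rule that)
qed

lemma ldim_pos:
  assumes "finite P" "P \<noteq> {}" "partial_order_on P r"
  shows "1 \<le> ldim P r"
proof -
  obtain R where R: "local_realizer P r R" "\<And>x. x \<in> P \<Longrightarrow> frequency x R \<le> ldim P r"
    using ldim_realizer assms by blast
  obtain z where z: "z \<in> P" using assms(2) by blast
  obtain L where "L \<in> R" "z \<in> Field L"
    using local_realizer_covers[OF R(1) z z] by blast
  then have "{L \<in> R. z \<in> Field L} \<noteq> {}" by blast
  then have "0 < frequency z R"
    unfolding frequency_def using finite_local_realizer[OF assms(1) R(1)] by (simp add: card_gt_0_iff)
  then show ?thesis using R(2)[OF z] by linarith
qed

subsection \<open>Linear extensions\<close>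

text \<open>Elements are sorted by level \<open>h\<close>, with ties broken by \<open>w\<close>.
  Every linear extension of the whole poset built below has this form.\<close>

definition lex_order :: "'a set \<Rightarrow> ('a \<Rightarrow> nat) \<Rightarrow> 'a rel \<Rightarrow> 'a rel" where
  "lex_order P h w = {(x, y). x \<in> P \<and> y \<in> P \<and> (h x < h y \<or> h x = h y \<and> (x, y) \<in> w)}"

lemma linear_order_on_lex_order:
  assumes "linear_order_on P w"
  shows "linear_order_on P (lex_order P h w)"
proof -
  have w: "refl_on P w" "trans w" "antisym w" "total_on P w"
    using assms by (auto simp: linear_order_on_def partial_order_on_def preorder_on_def)
  have "lex_order P h w \<subseteq> P \<times> P"
    by (auto simp: lex_order_def)
  moreover have "refl_on P (lex_order P h w)"
    using w(1) by (auto simp: refl_on_def lex_order_def)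
  moreover have "trans (lex_order P h w)"
    by (rule transI) (auto simp: lex_order_def dest: transD[OF w(2)])
  moreover have "antisym (lex_order P h w)"
    by (rule antisymI) (auto simp: lex_order_def dest: antisymD[OF w(3)])
  moreover have "total_on P (lex_order P h w)"
    using w(4) unfolding total_on_def lex_order_def by (auto simp: neq_iff)
  ultimately show ?thesis
    by (auto simp: linear_order_on_def partial_order_on_def preorder_on_def)
qed

lemma partial_linear_extension_linear_order:
  assumes "P \<noteq> {}" "linear_order_on P L" "r \<subseteq> L"
  shows "partial_linear_extension P r L"
  using assms unfolding partial_linear_extension_def by blast

text \<open>The size of the principal down-set grows strictly along \<open>r\<close>: the down-set
  of \<open>y\<close> contains \<open>y\<close> itself, that of a smaller \<open>x\<close> does not.
  An arbitrary well-order breaks ties.\<close>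

lemma linear_extension_exists:
  assumes fin: "finite P" and po: "partial_order_on P r"
  obtains L where "linear_order_on P L" "r \<subseteq> L"
proof -
  obtain w where w: "well_order_on P w" using well_order_on by blast
  have r: "r \<subseteq> P \<times> P" "refl_on P r" "trans r" "antisym r"
    using po by (auto simp: partial_order_on_def preorder_on_def)
  have lin: "linear_order_on P w"
    using w by (simp add: well_order_on_def)
  define h where "h x = card {q. (q, x) \<in> r}" for x
  have "(x, y) \<in> lex_order P h w" if xy: "(x, y) \<in> r" for x y
  proof (cases "x = y")
    case True
    then show ?thesis
      using xy r(1) lin
      by (auto simp: lex_order_def linear_order_on_def partial_order_on_def preorder_on_def refl_on_def)
  next
    case False
    have "finite {q. (q, y) \<in> r}"
      by (rule finite_subset[OF _ fin]) (use r(1) in auto)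
    moreover have "{q. (q, x) \<in> r} \<subset> {q. (q, y) \<in> r}"
    proof
      show "{q. (q, x) \<in> r} \<subseteq> {q. (q, y) \<in> r}"
        using xy transD[OF r(3)] by auto
      have "(y, y) \<in> r" "(y, x) \<notin> r"
        using xy r False antisymD[OF r(4), of x y] by (auto simp: refl_on_def)
      then show "{q. (q, x) \<in> r} \<noteq> {q. (q, y) \<in> r}" by auto
    qed
    ultimately have "h x < h y" unfolding h_def by (rule psubset_card_mono)
    then show ?thesis using xy r(1) by (auto simp: lex_order_def)
  qed
  then have "r \<subseteq> lex_order P h w" by auto
  with linear_order_on_lex_order[OF lin] show thesis by (rule that)
qed

text \<open>Adjoins \<open>a\<close> as least and \<open>b\<close> as greatest element; inserting
  both into the products also supplies the pairs \<open>(a, a)\<close>, \<open>(b, b)\<close> and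
  \<open>(a, b)\<close>.\<close>

definition add_bounds :: "'a \<Rightarrow> 'a \<Rightarrow> 'a rel \<Rightarrow> 'a rel" where
  "add_bounds a b L =
     L \<union> {a} \<times> insert a (insert b (Field L)) \<union> insert a (insert b (Field L)) \<times> {b}"

lemma Field_add_bounds: "Field (add_bounds a b L) = insert a (insert b (Field L))"
  by (auto simp: add_bounds_def Field_def)

lemma linear_order_on_add_bounds:
  assumes L: "linear_order_on (Field L) L" and ab: "a \<notin> Field L" "b \<notin> Field L" "a \<noteq> b"
  shows "linear_order_on (Field (add_bounds a b L)) (add_bounds a b L)"
proof -
  have L: "refl_on (Field L) L" "trans L" "antisym L" "total_on (Field L) L"
    using L by (auto simp: linear_order_on_def partial_order_on_def preorder_on_def)
  have F: "x \<in> Field L" "y \<in> Field L" if "(x, y) \<in> L" for x y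
    using that by (auto simp: Field_def)
  have "refl_on (Field (add_bounds a b L)) (add_bounds a b L)"
    using L(1) unfolding Field_add_bounds by (auto simp: refl_on_def add_bounds_def)
  moreover have "add_bounds a b L \<subseteq> Field (add_bounds a b L) \<times> Field (add_bounds a b L)"
    by (auto simp: Field_def)
  moreover have "trans (add_bounds a b L)"
    using ab by (intro transI) (auto simp: add_bounds_def dest: F transD[OF L(2)])
  moreover have "antisym (add_bounds a b L)"
    using ab by (intro antisymI) (auto simp: add_bounds_def dest: F antisymD[OF L(3)])
  moreover have "total_on (Field (add_bounds a b L)) (add_bounds a b L)"
    using L(4) unfolding Field_add_bounds total_on_def by (auto simp: add_bounds_def)
  ultimately show ?thesis
    by (auto simp: linear_order_on_def partial_order_on_def preorder_on_def)
qed

text \<open>Minimality of \<open>a\<close> and maximality of \<open>b\<close> ensure that no pair of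
  \<open>r\<close> contradicts their new extreme positions.\<close>

lemma partial_linear_extension_add_bounds:
  assumes L: "partial_linear_extension (P - {a, b}) (Restr r (P - {a, b})) L"
    and ab: "a \<in> P" "b \<in> P" "a \<noteq> b"
    and min: "\<And>q. (q, a) \<in> r \<Longrightarrow> q = a" and max: "\<And>q. (b, q) \<in> r \<Longrightarrow> q = b"
  shows "partial_linear_extension P r (add_bounds a b L)"
  unfolding partial_linear_extension_def
proof (intro exI[of _ "Field (add_bounds a b L)"] conjI)
  note D = partial_linear_extensionD[OF L]
  show "Field (add_bounds a b L) \<noteq> {}" "Field (add_bounds a b L) \<subseteq> P"
    using D(2) ab unfolding Field_add_bounds by auto
  show "linear_order_on (Field (add_bounds a b L)) (add_bounds a b L)"
    using D(2,3) ab(3) by (intro linear_order_on_add_bounds) auto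
  show "Restr r (Field (add_bounds a b L)) \<subseteq> add_bounds a b L"
    using D(2,4) unfolding Field_add_bounds by (auto simp: add_bounds_def dest: min max)
qed

lemma partial_order_on_Restr:
  assumes "partial_order_on P r" "Q \<subseteq> P"
  shows "partial_order_on Q (Restr r Q)"
  using assms unfolding partial_order_on_def preorder_on_def
  by (auto simp: refl_on_def trans_Restr intro: antisym_subset)

subsection \<open>Removable pairs\<close>

lemma ldim_remove_min_max_pair:
  assumes fin: "finite P" and po: "partial_order_on P r" and ne: "P - {a, b} \<noteq> {}"
    and ab: "a \<in> P" "b \<in> P" "a \<noteq> b" "(a, b) \<notin> r"
    and min: "\<And>q. (q, a) \<in> r \<Longrightarrow> q = a" and max: "\<And>q. (b, q) \<in> r \<Longrightarrow> q = b"
  shows "ldim P r \<le> ldim (P - {a, b}) (Restr r (P - {a, b})) + 1"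
proof -
  let ?Q = "P - {a, b}"
  let ?s = "Restr r ?Q"
  let ?k = "ldim ?Q ?s"
  have rP: "r \<subseteq> P \<times> P" and tr: "trans r" and rf: "refl_on P r"
    using po by (auto simp: partial_order_on_def preorder_on_def)
  obtain R where R: "local_realizer ?Q ?s R" and freq: "\<And>x. x \<in> ?Q \<Longrightarrow> frequency x R \<le> ?k"
    using ldim_realizer[of ?Q ?s] fin ne partial_order_on_Restr[OF po, of ?Q] by auto
  have finR: "finite R"
    using finite_local_realizer[OF _ R] fin by simp
  have ple: "partial_linear_extension ?Q ?s L" if "L \<in> R" for L
    using R that unfolding local_realizer_def by blast
  have FR: "Field L \<subseteq> ?Q" if "L \<in> R" for L
    using partial_linear_extensionD(2)[OF ple[OF that]] .
  \<comment> \<open>Any remaining element serves: at most \<open>?k\<close> members contain it, and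
    together they meet every element of \<open>?Q\<close>.\<close>
  obtain z where z: "z \<in> ?Q" using ne by blast
  define g where "g L = (if z \<in> Field L then add_bounds a b L else L)" for L
  obtain w where w: "linear_order_on P w" "r \<subseteq> w"
    using linear_extension_exists[OF fin po] by blast
  \<comment> \<open>Level 1 puts \<open>b\<close> directly above its strict lower bounds, and level
    3 puts \<open>a\<close> directly below its strict upper bounds; everything else gets level 2.
    Levels 0 and 4 cannot compete, because an element above \<open>a\<close> and below
    \<open>b\<close> would give \<open>(a, b) \<in> r\<close>.\<close>
  define h :: "'a \<Rightarrow> nat" where
    "h x = (if x = b then 1 else if x = a then 3 else if (x, b) \<in> r then 0
            else if (a, x) \<in> r then 4 else 2)" for x
  define M where "M = lex_order P h w"
  have disj: "(a, x) \<notin> r" if "(x, b) \<in> r" for x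
    using that ab(4) transD[OF tr] by blast
  have mono: "h x \<le> h y" if "(x, y) \<in> r" for x y
    using that disj min[of x] max[of y] ab transD[OF tr, of x y b] transD[OF tr, of a x y]
    unfolding h_def by auto
  \<comment> \<open>The levels are only weakly monotone along \<open>r\<close>; within a level the
    tie-break \<open>w\<close> already extends \<open>r\<close>.\<close>
  have "r \<subseteq> M"
    using w(2) rP unfolding M_def lex_order_def by (force dest: mono)
  then have "partial_linear_extension P r M"
    using ab(1) linear_order_on_lex_order[OF w(1), of h] unfolding M_def
    by (intro partial_linear_extension_linear_order) auto
  moreover have "partial_linear_extension P r (g L)" if L: "L \<in> R" for L
  proof (cases "z \<in> Field L")
    case True
    then show ?thesis
      using partial_linear_extension_add_bounds[OF ple[OF L] ab(1-3) min max] by (simp add: g_def)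
  next
    case False
    have "Restr r (Field L) \<subseteq> L"
      using partial_linear_extensionD(4)[OF ple[OF L]] FR[OF L] by blast
    then have "partial_linear_extension P r L"
      using partial_linear_extensionD[OF ple[OF L]] unfolding partial_linear_extension_def
      by (intro exI[of _ "Field L"]) auto
    with False show ?thesis by (simp add: g_def)
  qed
  moreover have "\<exists>L\<in>insert M (g ` R). (x, y) \<in> L"
    if xy: "x \<in> P" "y \<in> P" "x \<noteq> y" "(y, x) \<notin> r" for x y
  proof -
    \<comment> \<open>Pairs with \<open>a\<close> on top or \<open>b\<close> at the bottom come from
      \<open>M\<close>; pairs with \<open>a\<close> at the bottom or \<open>b\<close> on top come
      from enlarged members containing \<open>z\<close>.\<close>
    consider "x \<in> ?Q" "y \<in> ?Q" | "y = a" | "x = b" | "x = a" "y = b"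
      | "x = a" "y \<in> ?Q" | "y = b" "x \<in> ?Q"
      using xy by blast
    then show ?thesis
    proof cases
      case 1
      then obtain L where "L \<in> R" "(x, y) \<in> L"
        using local_realizer_pairD[OF R 1 xy(3)] xy(4) by blast
      then have "L \<in> R" "(x, y) \<in> g L" by (simp_all add: g_def add_bounds_def)
      then show ?thesis by blast
    next
      case 2
      then have "h x < h y" using xy ab(3) by (auto simp: h_def)
      then show ?thesis using xy by (auto simp: M_def lex_order_def)
    next
      case 3
      then have "h x < h y" using xy ab(3) by (auto simp: h_def)
      then show ?thesis using xy by (auto simp: M_def lex_order_def)
    next
      case 4
      obtain L where "L \<in> R" "z \<in> Field L"
        using local_realizer_covers[OF R z z] by blast
      then have "L \<in> R" "(x, y) \<in> g L" using 4 by (simp_all add: g_def add_bounds_def)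
      then show ?thesis by blast
    next
      case 5
      obtain L where "L \<in> R" "z \<in> Field L" "y \<in> Field L"
        using local_realizer_covers[OF R z 5(2)] by blast
      then have "L \<in> R" "(x, y) \<in> g L" using 5 by (simp_all add: g_def add_bounds_def)
      then show ?thesis by blast
    next
      case 6
      obtain L where "L \<in> R" "z \<in> Field L" "x \<in> Field L"
        using local_realizer_covers[OF R z 6(2)] by blast
      then have "L \<in> R" "(x, y) \<in> g L" using 6 by (simp_all add: g_def add_bounds_def)
      then show ?thesis by blast
    qed
  qed
  ultimately have real: "local_realizer P r (insert M (g ` R))"
    by (intro local_realizerI[OF po]) auto
  have "frequency x (insert M (g ` R)) \<le> ?k + 1" if x: "x \<in> P" for x
  proof -
    \<comment> \<open>The elements \<open>a\<close> and \<open>b\<close> enter exactly the members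
      containing \<open>z\<close>, so their frequency is charged to \<open>z\<close>. The extra 1 in
      the bound accounts for \<open>M\<close>.\<close>
    define t where "t = (if x \<in> ?Q then x else z)"
    have t: "t \<in> ?Q" using z by (simp add: t_def)
    have "x \<in> Field (g L) \<Longrightarrow> t \<in> Field L" if "L \<in> R" for L
      using FR[OF that] x by (auto simp: g_def t_def Field_add_bounds split: if_splits)
    then have "{L \<in> insert M (g ` R). x \<in> Field L} \<subseteq> insert M (g ` {L \<in> R. t \<in> Field L})"
      by auto
    then have "frequency x (insert M (g ` R)) \<le> card (insert M (g ` {L \<in> R. t \<in> Field L}))"
      unfolding frequency_def using finR by (intro card_mono) auto
    also have "\<dots> \<le> Suc (card (g ` {L \<in> R. t \<in> Field L}))"
      using finR by (simp add: card_insert_if)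
    \<comment> \<open>Members identified by \<open>g\<close> could only lower the count, so
      injectivity is not at issue.\<close>
    also have "\<dots> \<le> Suc (frequency t R)"
      unfolding frequency_def using finR by (simp add: card_image_le)
    also have "\<dots> \<le> ?k + 1"
      using freq[OF t] by simp
    finally show ?thesis .
  qed
  then show ?thesis
    using ldim_le[OF fin _ real] ab(1) by blast
qed

text \<open>Otherwise \<open>x\<close>, \<open>y\<close>, \<open>z\<close> would form a
  three-element chain. Thus every element that is not minimal is maximal.\<close>

lemma height_le_2D:
  assumes fin: "finite P" and po: "partial_order_on P r" and "height P r \<le> 2"
    and xy: "(x, y) \<in> r" "x \<noteq> y" and yz: "(y, z) \<in> r"
  shows "y = z"
proof (rule ccontr)
  assume ne: "y \<noteq> z"
  have r: "r \<subseteq> P \<times> P" "refl_on P r" "trans r" "antisym r"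
    using po by (auto simp: partial_order_on_def preorder_on_def)
  have xz: "(x, z) \<in> r" using transD[OF r(3) xy(1) yz] .
  have "x \<noteq> z" using antisymD[OF r(4), of x y] xy yz by auto
  then have c: "card {x, y, z} = 3" using xy(2) ne by simp
  have "{x, y, z} \<in> Chains r" and sub: "{x, y, z} \<subseteq> P"
    using r(1,2) xy(1) yz xz by (auto simp: Chains_def refl_on_def)
  then have "card {x, y, z} \<in> {card C | C. C \<subseteq> P \<and> C \<in> Chains r}" by blast
  moreover have "finite {card C | C. C \<subseteq> P \<and> C \<in> Chains r}"
    by (rule finite_subset[of _ "card ` Pow P"]) (use fin in auto)
  ultimately have "card {x, y, z} \<le> height P r"
    unfolding height_def by (intro Max_ge)
  with c assms(3) show False by simp
qed

text \<open>Only pairs on the same level can be incomparable, so two linear extensions with the same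
  levels and opposite tie-breaks realize the order.\<close>

lemma ldim_complete_bipartite_le:
  assumes fin: "finite P" and ne: "P \<noteq> {}" and po: "partial_order_on P r" and ht: "height P r \<le> 2"
    and complete: "\<And>a b. \<lbrakk>a \<in> P; b \<in> P; a \<noteq> b; \<forall>q. (q, a) \<in> r \<longrightarrow> q = a; \<forall>q. (b, q) \<in> r \<longrightarrow> q = b\<rbrakk>
      \<Longrightarrow> (a, b) \<in> r"
  shows "ldim P r \<le> 2"
proof -
  have r: "r \<subseteq> P \<times> P" "antisym r"
    using po by (auto simp: partial_order_on_def preorder_on_def)
  obtain w where "well_order_on P w" using well_order_on by blast
  then have w: "linear_order_on P w" by (simp add: well_order_on_def)
  then have w': "linear_order_on P (w\<inverse>)" by simp
  define h :: "'a \<Rightarrow> nat" where "h x = (if \<forall>q. (q, x) \<in> r \<longrightarrow> q = x then 0 else 1)" for x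
  have strict: "h x < h y" if "(x, y) \<in> r" "x \<noteq> y" for x y
    using that height_le_2D[OF fin po ht, of _ x y] by (auto simp: h_def)
  have ext: "partial_linear_extension P r (lex_order P h v)" if v: "linear_order_on P v" for v
  proof (rule partial_linear_extension_linear_order[OF ne linear_order_on_lex_order[OF v]])
    have "refl_on P v"
      using v by (auto simp: linear_order_on_def partial_order_on_def preorder_on_def)
    then show "r \<subseteq> lex_order P h v"
      using r(1) strict by (fastforce simp: lex_order_def refl_on_def)
  qed
  have "\<exists>L\<in>{lex_order P h w, lex_order P h (w\<inverse>)}. (x, y) \<in> L"
    if xy: "x \<in> P" "y \<in> P" "x \<noteq> y" "(y, x) \<notin> r" for x y
  proof -
    \<comment> \<open>Otherwise \<open>y\<close> would be minimal and \<open>x\<close>, lying above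
      another element, maximal; completeness would then give the excluded relation
      \<open>(y, x) \<in> r\<close>.\<close>
    have "\<not> h y < h x"
    proof
      assume "h y < h x"
      then have "\<forall>q. (q, y) \<in> r \<longrightarrow> q = y" and "\<exists>q. (q, x) \<in> r \<and> q \<noteq> x"
        by (auto simp: h_def split: if_splits)
      moreover from this(2) have "\<forall>q. (x, q) \<in> r \<longrightarrow> q = x"
        using height_le_2D[OF fin po ht] by blast
      ultimately show False using complete[of y x] xy by blast
    qed
    moreover have "(x, y) \<in> w \<or> (y, x) \<in> w"
      using w xy by (auto simp: linear_order_on_def total_on_def)
    ultimately show ?thesis
      using xy by (auto simp: lex_order_def)
  qed
  then have real: "local_realizer P r {lex_order P h w, lex_order P h (w\<inverse>)}"
    using ext w w' by (intro local_realizerI[OF po]) auto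
  have "frequency x {L, L'} \<le> 2" for x and L L' :: "'a rel"
  proof -
    have "frequency x {L, L'} \<le> card {L, L'}"
      unfolding frequency_def by (intro card_mono) auto
    also have "\<dots> \<le> 2" by (simp add: card_insert_if)
    finally show ?thesis .
  qed
  then show ?thesis using ldim_le[OF fin ne real] by blast
qed

theorem theorem7:
  fixes P :: "'a set" and r :: "'a rel"
  assumes "finite P"
    and "partial_order_on P r"
    and "card P \<ge> 3"
    and "height P r \<le> 2"
  shows "\<exists>x\<in>P. \<exists>y\<in>P. x \<noteq> y \<and>
    ldim P r \<le> ldim (P - {x, y}) (Restr r (P - {x, y})) + 1"
proof -
  \<comment> \<open>Removing two of at least three elements leaves a nonempty poset, as both cases
    below require.\<close>
  have ne: "P - {x, y} \<noteq> {}" for x y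
  proof
    assume "P - {x, y} = {}"
    then have "card P \<le> card {x, y}" by (intro card_mono) auto
    also have "\<dots> \<le> 2" by (simp add: card_insert_if)
    finally show False using assms(3) by simp
  qed
  show ?thesis
  proof (cases "\<exists>a\<in>P. \<exists>b\<in>P. a \<noteq> b \<and> (a, b) \<notin> r \<and>
      (\<forall>q. (q, a) \<in> r \<longrightarrow> q = a) \<and> (\<forall>q. (b, q) \<in> r \<longrightarrow> q = b)")
    case True
    then show ?thesis
      using ldim_remove_min_max_pair[OF assms(1,2) ne] by meson
  next
    case False
    \<comment> \<open>Here any two distinct elements will do: the whole poset has local dimension at
      most 2, and what remains has at least 1.\<close>
    obtain x y where xy: "x \<in> P" "y \<in> P" "x \<noteq> y"
      using ne by (metis Diff_iff ex_in_conv insertI1)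
    have "ldim P r \<le> 2"
      using ldim_complete_bipartite_le[OF assms(1) _ assms(2,4)] xy(1) False by blast
    moreover have "1 \<le> ldim (P - {x, y}) (Restr r (P - {x, y}))"
      using ldim_pos[OF _ ne partial_order_on_Restr[OF assms(2)]] assms(1) by blast
    ultimately show ?thesis using xy by force
  qed
qed

end
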